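(* Let $(X_n)_{n\geq 1}$ be independent standard Gaussian random variables and let $F(\sigma)=\sum_{n=1}^\infty X_n n^{-\sigma}$ for real $\sigma>1/2$. For $1/2<T<1$ let $N(T,1)$ denote the number of real zeros of $F$ in $[T,1]$, each counted without multiplicity. There exists a constant $C>0$ such that for all real $k\geq 1$ and all $1/2<T<1$, $$\mathbb{E}\, N(T,1)^k \leq \left(Ck \log\left(\frac{1}{T-1/2}\right) \right)^k.$$ *)

theory Defs
  imports "HOL-Probability.Probability"
begin

text \<open>
  The series is indexed from \<open>n = 1\<close>, i.e. by \<open>Suc n\<close>. It is only conditionally convergent for
  \<open>1/2 < \<sigma> \<le> 1\<close>; when the \<open>X\<^sub>n\<close> are independent standard Gaussians it converges, almost surely,
  for all \<open>\<sigma> > 1/2\<close> simultaneously, so the values of \<open>suminf\<close> at divergent series only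
  matter on a null set.
\<close>

definition gauss_dirichlet :: "(nat \<Rightarrow> 'a \<Rightarrow> real) \<Rightarrow> 'a \<Rightarrow> real \<Rightarrow> real" where
  "gauss_dirichlet X \<omega> \<sigma> = (\<Sum>n. X (Suc n) \<omega> * real (Suc n) powr (- \<sigma>))"

text \<open>
  Counting measure is used instead of \<open>card\<close> so that an infinite zero set counts as \<open>\<infinity>\<close>.
  Off the null set where the series fails to converge on all of \<open>(1/2, \<infinity>)\<close>, the zero count of the
  continuous random function is measurable in \<open>\<omega>\<close>; hence the integral of its powers, which is
  invariant under changes on null sets, is the expectation.
\<close>

definition num_zeros :: "(nat \<Rightarrow> 'a \<Rightarrow> real) \<Rightarrow> real \<Rightarrow> real \<Rightarrow> 'a \<Rightarrow> ennreal" where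
  "num_zeros X a b \<omega> = emeasure (count_space UNIV) {\<sigma> \<in> {a..b}. gauss_dirichlet X \<omega> \<sigma> = 0}"

text \<open>Real powers on \<open>[0, \<infinity>]\<close>, for positive exponents only.\<close>

definition ennreal_powr :: "ennreal \<Rightarrow> real \<Rightarrow> ennreal" where
  "ennreal_powr x p = (if x = \<infinity> then \<infinity> else ennreal (enn2real x powr p))"

end

theory Submission
  imports Defs "HOL-Complex_Analysis.Complex_Analysis"
begin

text \<open>
  Almost surely the partial sums of the \<open>X\<^sub>n\<close> are \<open>O(n\<^bsup>1/2 + \<epsilon>\<^esup>)\<close> for every \<open>\<epsilon> > 0\<close> (high moments),
  so summation by parts extends \<open>F\<close> to a holomorphic function on \<open>Re s > 1/2\<close>.
  Cut \<open>[T, 1]\<close> into \<open>J \<le> log\<^sub>2 (1/(T - 1/2))\<close> intervals \<open>[1/2 + a, 1/2 + 2a]\<close> with dyadic \<open>a\<close>. Dividing \<open>F\<close> by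
  the linear factors of its zeros in such an interval and applying the mean value property on the
  circle of radius \<open>5a/4\<close> around the midpoint \<open>z\<close> shows, as in Jensen's formula, that the number \<open>n\<close>
  of these zeros satisfies \<open>(3/2)\<^bsup>n\<^esup> \<bar>F(z)\<bar> \<le>\<close> the mean of \<open>\<bar>F\<bar>\<close> on the circle. Since \<open>F\<close> has variance of
  exact order \<open>1/a\<close> at \<open>z\<close> and at most of that order on the circle, and a Gaussian has a finite
  moment of order \<open>-1/2\<close>, \<open>exp (c n)\<close> has expectation bounded independently of \<open>a\<close>. Convexity of the
  exponential combines the intervals: if their zero counts sum to \<open>n\<close>, then \<open>exp (c n / J)\<close> has bounded
  expectation, and \<open>n\<^bsup>k\<^esup> \<le> (J k / c)\<^bsup>k\<^esup> exp (c n / J)\<close>.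
\<close>

subsection \<open>Zeros of holomorphic functions and circle means\<close>

text \<open>Zeros are peeled off one at a time: the factors removed earlier do not vanish at the new
  point \<open>a\<close>, so the cofactor does, and its difference quotient at \<open>a\<close> is
  again holomorphic. Each point is divided out once, in line with counting without
  multiplicity.\<close>

lemma holomorphic_factor_finite_zeros:
  assumes S: "open S" and "finite A" and "f holomorphic_on S" and "A \<subseteq> S" and "\<And>a. a \<in> A \<Longrightarrow> f a = 0"
  obtains g where "g holomorphic_on S" "\<And>z. z \<in> S \<Longrightarrow> f z = (\<Prod>a\<in>A. z - a) * g z"
  using assms(2-5)
proof (induction A arbitrary: thesis rule: finite_induct)
  case empty
  then show ?case by simp
next
  case (insert a A)
  obtain g where g: "g holomorphic_on S" "\<And>z. z \<in> S \<Longrightarrow> f z = (\<Prod>a\<in>A. z - a) * g z"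
    using insert.IH insert.prems by (metis insert_iff insert_subset)
  have "(\<Prod>b\<in>A. a - b) \<noteq> 0"
    using insert.hyps by auto
  then have ga: "g a = 0"
    using g(2)[of a] insert.prems by auto
  \<comment> \<open>The derivative fills the removable singularity of the difference quotient at
    \<open>a\<close>.\<close>
  define h where "h = (\<lambda>z. if z = a then deriv g a else (g z - g a) / (z - a))"
  have "h holomorphic_on S"
    unfolding h_def using g(1) S by (rule pole_lemma_open)
  moreover have "f z = (\<Prod>b\<in>insert a A. z - b) * h z" if "z \<in> S" for z
    using insert.hyps g(2)[OF that] ga by (auto simp: h_def)
  ultimately show ?case
    using insert.prems by blast
qed

text \<open>This is Cauchy's integral formula: the derivative of the parametrised circle cancels the
  denominator up to the constant \<open>2 * pi * \<i>\<close>.\<close>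

lemma circlepath_mean_value:
  assumes "continuous_on (cball z R) f" "f holomorphic_on ball z R" "0 < R"
  shows "((\<lambda>t. f (circlepath z R t)) has_integral f z) {0..1}"
proof -
  have "((\<lambda>u. f u / (u - z)) has_contour_integral (2 * of_real pi * \<i> * f z)) (circlepath z R)"
    using Cauchy_integral_circlepath[of z R f z] assms by simp
  then have "((\<lambda>t. f (circlepath z R t) / (circlepath z R t - z) * vector_derivative (circlepath z R) (at t))
      has_integral (2 * of_real pi * \<i> * f z)) {0..1}"
    by (simp add: has_contour_integral)
  then have "((\<lambda>t. 2 * of_real pi * \<i> * f (circlepath z R t)) has_integral (2 * of_real pi * \<i> * f z)) {0..1}"
  proof (rule has_integral_eq[rotated])
    fix t :: real
    have "circlepath z R t - z = of_real R * exp (2 * of_real pi * \<i> * of_real t)"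
      by (simp add: circlepath)
    then show "f (circlepath z R t) / (circlepath z R t - z) * vector_derivative (circlepath z R) (at t)
        = 2 * of_real pi * \<i> * f (circlepath z R t)"
      using \<open>0 < R\<close> by (simp add: vector_derivative_circlepath field_simps)
  qed
  from has_integral_mult_right[OF this, of "inverse (2 * of_real pi * \<i>)"] show ?thesis
    by (simp add: field_simps)
qed

text \<open>A relative of Jensen's formula that uses the mean of the modulus instead of its
  logarithm. Each linear factor is at least \<open>R - r\<close> in modulus on the circle and at
  most \<open>r\<close> at the center; the mean value property of the quotient \<open>g\<close>
  links the two places.\<close>

lemma zeros_bound_circle_mean:
  assumes S: "open S" and hol: "f holomorphic_on S" and RS: "cball z R \<subseteq> S" and r: "0 < r" "r < R"
    and A: "finite A" "A \<subseteq> cball z r" "\<And>a. a \<in> A \<Longrightarrow> f a = 0"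
  shows "(R - r) ^ card A * norm (f z) \<le> r ^ card A * integral {0..1} (\<lambda>t. norm (f (circlepath z R t)))"
proof -
  have "A \<subseteq> S" using A(2) RS r by fastforce
  then obtain g where g: "g holomorphic_on S" "\<And>z. z \<in> S \<Longrightarrow> f z = (\<Prod>a\<in>A. z - a) * g z"
    using holomorphic_factor_finite_zeros[OF S A(1) hol _ A(3)] by blast
  have cin: "circlepath z R t \<in> cball z R" and cn: "norm (circlepath z R t - z) = R" for t
    using r by (auto simp: circlepath dist_norm norm_mult)
  have g': "((\<lambda>t. g (circlepath z R t)) has_integral g z) {0..1}"
  proof (rule circlepath_mean_value)
    show "continuous_on (cball z R) g"
      using g(1) RS holomorphic_on_imp_continuous_on continuous_on_subset by blast
    show "g holomorphic_on ball z R"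
      using g(1) RS ball_subset_cball holomorphic_on_subset by blast
  qed (use r in simp)
  have cont: "continuous_on {0..1} (\<lambda>t. norm (f (circlepath z R t)))"
  proof -
    have "continuous_on {0..1} (circlepath z R)"
      unfolding circlepath by (intro continuous_intros)
    then show ?thesis
      by (intro continuous_on_norm continuous_on_compose2[OF holomorphic_on_imp_continuous_on[OF hol]])
        (use subsetD[OF RS cin] in blast)+
  qed
  have pt: "(R - r) ^ card A * norm (g (circlepath z R t)) \<le> norm (f (circlepath z R t))" for t
  proof -
    have "(R - r) ^ card A = (\<Prod>a\<in>A. R - r)" by simp
    also have "\<dots> \<le> (\<Prod>a\<in>A. norm (circlepath z R t - a))"
    proof (rule prod_mono)
      fix a assume "a \<in> A"
      then have "norm (a - z) \<le> r" using A(2) by (auto simp: dist_norm norm_minus_commute)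
      then show "0 \<le> R - r \<and> R - r \<le> norm (circlepath z R t - a)"
        using norm_triangle_ineq2[of "circlepath z R t - z" "a - z"] cn[of t] r by simp
    qed
    also have "\<dots> = norm (\<Prod>a\<in>A. circlepath z R t - a)"
      by (simp add: prod_norm)
    finally show ?thesis
      using g(2)[OF subsetD[OF RS cin]] by (simp add: norm_mult mult_right_mono)
  qed
  have "norm (g z) \<le> integral {0..1} (\<lambda>t. norm (f (circlepath z R t)) / (R - r) ^ card A)"
    unfolding integral_unique[OF g', symmetric]
  proof (rule integral_norm_bound_integral)
    show "(\<lambda>t. g (circlepath z R t)) integrable_on {0..1}" using g' by blast
    show "(\<lambda>t. norm (f (circlepath z R t)) / (R - r) ^ card A) integrable_on {0..1}"
      using r by (intro integrable_continuous_real continuous_on_divide cont continuous_on_const) auto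
    show "norm (g (circlepath z R t)) \<le> norm (f (circlepath z R t)) / (R - r) ^ card A" if "t \<in> {0..1}" for t
      using pt[of t] r by (simp add: field_simps)
  qed
  then have gz: "(R - r) ^ card A * norm (g z) \<le> integral {0..1} (\<lambda>t. norm (f (circlepath z R t)))"
    using r by (simp add: field_simps)
  have "norm (\<Prod>a\<in>A. z - a) \<le> (\<Prod>a\<in>A. r)"
    unfolding prod_norm[symmetric] using A(2) by (intro prod_mono) (auto simp: dist_norm)
  then have "norm (\<Prod>a\<in>A. z - a) \<le> r ^ card A" by simp
  moreover have "norm (f z) = norm (\<Prod>a\<in>A. z - a) * norm (g z)"
    using g(2)[of z] subsetD[OF RS, of z] r by (simp add: norm_mult)
  ultimately have "norm (f z) \<le> r ^ card A * norm (g z)"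
    by (simp add: mult_right_mono)
  then have "(R - r) ^ card A * norm (f z) \<le> r ^ card A * ((R - r) ^ card A * norm (g z))"
    using r by (metis less_eq_real_def diff_gt_0_iff_gt mult.left_commute mult_left_mono zero_le_power)
  also have "\<dots> \<le> r ^ card A * integral {0..1} (\<lambda>t. norm (f (circlepath z R t)))"
    using gz r by (intro mult_left_mono) auto
  finally show ?thesis .
qed

subsection \<open>Convergence of Dirichlet series\<close>

lemma sum_mult_by_parts:
  fixes a u :: "nat \<Rightarrow> 'a :: comm_ring"
  shows "(\<Sum>n<N. a n * u n) = (\<Sum>n<N. (\<Sum>m<Suc n. a m) * (u n - u (Suc n))) + (\<Sum>m<N. a m) * u N"
  by (induction N) (auto simp: algebra_simps)

text \<open>Mean value inequality on the real segment from \<open>n\<close> to \<open>n + 1\<close>,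
  where the derivative \<open>- s * z powr (- s - 1)\<close> is largest in modulus at
  \<open>n\<close> because \<open>Re s\<close> is nonnegative.\<close>

lemma norm_powr_Suc_diff_le:
  assumes "0 < n" "0 \<le> Re s"
  shows "norm (of_nat n powr (-s) - of_nat (Suc n) powr (-s)) \<le> norm s * real n powr (- Re s - 1)"
proof -
  let ?S = "closed_segment (complex_of_real (real n)) (complex_of_real (real (Suc n)))"
  have S: "z \<in> \<real> \<and> real n \<le> Re z" if "z \<in> ?S" for z
    using that unfolding closed_segment_of_real by (auto simp: closed_segment_eq_real_ivl)
  have "norm (complex_of_real (real n) powr (-s) - complex_of_real (real (Suc n)) powr (-s))
      \<le> (norm s * real n powr (- Re s - 1)) * norm (complex_of_real (real n) - complex_of_real (real (Suc n)))"
  proof (rule field_differentiable_bound[where S = ?S and f' = "\<lambda>z. - s * z powr (- s - 1)"])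
    fix z assume "z \<in> ?S"
    then have z: "z \<in> \<real>" "real n \<le> Re z" using S by auto
    then have "0 < Re z" using assms by linarith
    then have "z \<notin> \<real>\<^sub>\<le>\<^sub>0" by (auto simp: complex_nonpos_Reals_iff)
    then show "((\<lambda>z. z powr (-s)) has_field_derivative - s * z powr (- s - 1)) (at z within ?S)"
      by (auto intro!: derivative_eq_intros)
    have "norm (z powr (- s - 1)) = Re z powr (- Re s - 1)"
      using z \<open>0 < Re z\<close> by (simp add: norm_powr_real_powr)
    also have "\<dots> \<le> real n powr (- Re s - 1)"
      using assms z by (intro powr_mono2') auto
    finally show "norm (- s * z powr (- s - 1)) \<le> norm s * real n powr (- Re s - 1)"
      by (simp add: norm_mult mult_left_mono)
  qed auto
  also have "norm (complex_of_real (real n) - complex_of_real (real (Suc n))) = 1"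
    by (simp add: norm_minus_commute)
  finally show ?thesis by simp
qed

text \<open>After summation by parts the terms are of order
  \<open>n powr (\<alpha> - \<beta> - 1)\<close>, so the Weierstrass test applies, and the boundary
  term is of order \<open>N powr (\<alpha> - \<beta>)\<close>, which tends to 0.\<close>

lemma dirichlet_series_uniform_limit:
  fixes a :: "nat \<Rightarrow> complex" and K \<alpha> :: real
  assumes A: "\<And>n. norm (\<Sum>m<n. a m) \<le> K * real n powr \<alpha>" and "0 \<le> \<alpha>" and w: "\<alpha> < Re w"
  shows "uniform_limit (cball w ((Re w - \<alpha>) / 2)) (\<lambda>N s. \<Sum>n<N. a n * of_nat (Suc n) powr (-s))
     (\<lambda>s. \<Sum>n. a n * of_nat (Suc n) powr (-s)) sequentially"
proof -
  define d where "d = (Re w - \<alpha>) / 2"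
  \<comment> \<open>The midpoint of \<open>\<alpha>\<close> and \<open>Re w\<close> is the least
    real part on the disc of radius \<open>d\<close>.\<close>
  define \<beta> where "\<beta> = (\<alpha> + Re w) / 2"
  define B where "B = norm w + d"
  have d: "0 < d" "\<alpha> < \<beta>" using w by (auto simp: d_def \<beta>_def)
  have K: "0 \<le> K" using order_trans[OF norm_ge_zero A[of 1]] by simp
  have s: "\<beta> \<le> Re s" "norm s \<le> B" if "s \<in> cball w d" for s
  proof -
    have "norm (s - w) \<le> d" using that by (simp add: dist_norm norm_minus_commute)
    then show "norm s \<le> B" using norm_triangle_ineq2[of s w] by (simp add: B_def)
    have "\<bar>Re s - Re w\<bar> \<le> d"
      using abs_Re_le_cmod[of "s - w"] \<open>norm (s - w) \<le> d\<close> by simp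
    then show "\<beta> \<le> Re s" unfolding \<beta>_def d_def by argo
  qed
  define g where "g n s = (\<Sum>m<Suc n. a m) * (of_nat (Suc n) powr (-s) - of_nat (Suc (Suc n)) powr (-s))"
    for n and s :: complex
  have g: "norm (g n s) \<le> K * B * real (Suc n) powr (\<alpha> - \<beta> - 1)" if "s \<in> cball w d" for n s
  proof -
    have "norm (g n s) \<le> (K * real (Suc n) powr \<alpha>) * (norm s * real (Suc n) powr (- Re s - 1))"
      unfolding g_def norm_mult
      using A[of "Suc n"] s[OF that] d \<open>0 \<le> \<alpha>\<close> K
      by (intro mult_mono norm_powr_Suc_diff_le) auto
    also have "\<dots> \<le> (K * real (Suc n) powr \<alpha>) * (B * real (Suc n) powr (- \<beta> - 1))"
      using s[OF that] K order_trans[OF norm_ge_zero s(2)[OF that]]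
      by (intro mult_mono powr_mono mult_nonneg_nonneg) auto
    also have "\<dots> = K * B * real (Suc n) powr (\<alpha> + (- \<beta> - 1))"
      unfolding powr_add by simp
    finally show ?thesis by (simp add: algebra_simps)
  qed
  have summ: "summable (\<lambda>n. K * B * real (Suc n) powr (\<alpha> - \<beta> - 1))"
    using d summable_Suc_iff[of "\<lambda>n. real n powr (\<alpha> - \<beta> - 1)"]
    by (intro summable_mult) (simp add: summable_real_powr_iff del: of_nat_Suc)
  have lim1: "uniform_limit (cball w d) (\<lambda>N s. \<Sum>n<N. g n s) (\<lambda>s. \<Sum>n. g n s) sequentially"
    using g summ by (rule Weierstrass_m_test)
  have lim2: "uniform_limit (cball w d) (\<lambda>N s. (\<Sum>m<N. a m) * of_nat (Suc N) powr (-s)) (\<lambda>_. 0) sequentially"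
  proof (rule uniform_limitI)
    fix e :: real assume "0 < e"
    have "(\<lambda>N. K * real (Suc N) powr (\<alpha> - \<beta>)) \<longlonglongrightarrow> K * 0"
      using d by (intro tendsto_mult tendsto_const tendsto_neg_powr filterlim_compose[OF filterlim_real_sequentially filterlim_Suc]) auto
    then have "eventually (\<lambda>N. K * real (Suc N) powr (\<alpha> - \<beta>) < e) sequentially"
      using \<open>0 < e\<close> by (auto elim!: order_tendstoD)
    then show "eventually (\<lambda>N. \<forall>s\<in>cball w d. dist ((\<Sum>m<N. a m) * of_nat (Suc N) powr (-s)) 0 < e) sequentially"
    proof (eventually_elim, intro ballI)
      fix N s assume N: "K * real (Suc N) powr (\<alpha> - \<beta>) < e" and "s \<in> cball w d"
      have "norm ((\<Sum>m<N. a m) * of_nat (Suc N) powr (-s)) = norm (\<Sum>m<N. a m) * real (Suc N) powr (- Re s)"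
        by (simp add: norm_mult norm_powr_real_powr del: of_nat_Suc)
      \<comment> \<open>The sum has \<open>N\<close> terms while the power is taken at
        \<open>N + 1\<close>; enlarging the bound to \<open>Suc N\<close> lets the exponents be
        added.\<close>
      also have "\<dots> \<le> (K * real (Suc N) powr \<alpha>) * real (Suc N) powr (- \<beta>)"
        using s[OF \<open>s \<in> cball w d\<close>] K \<open>0 \<le> \<alpha>\<close>
        by (intro mult_mono powr_mono order_trans[OF A] mult_left_mono powr_mono2) auto
      also have "\<dots> = K * real (Suc N) powr (\<alpha> + - \<beta>)"
        unfolding powr_add by simp
      finally show "dist ((\<Sum>m<N. a m) * of_nat (Suc N) powr (-s)) 0 < e" using N by simp
    qed
  qed
  have lim: "uniform_limit (cball w d) (\<lambda>N s. \<Sum>n<N. a n * of_nat (Suc n) powr (-s)) (\<lambda>s. \<Sum>n. g n s) sequentially"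
    using uniform_limit_add[OF lim1 lim2] unfolding g_def
    by (subst sum_mult_by_parts) simp
  \<comment> \<open>The rearranged series and the original one are limits of the same partial
    sums.\<close>
  moreover have "(\<Sum>n. g n s) = (\<Sum>n. a n * of_nat (Suc n) powr (-s))" if "s \<in> cball w d" for s
    using tendsto_uniform_limitI[OF lim that] by (simp add: sums_def sums_unique)
  ultimately show ?thesis
    unfolding d_def[symmetric] by (subst uniform_limit_cong'[where g = "\<lambda>N s. \<Sum>n<N. a n * of_nat (Suc n) powr (-s)" and i = "\<lambda>s. \<Sum>n. g n s"]) auto
qed

text \<open>The exponents \<open>\<alpha> + 1 / real (Suc p)\<close> stand for
  \<open>\<alpha>\<close> plus an arbitrary positive number, but are countably many, so that an
  almost sure bound can supply them all at once. Near each point of the half-plane one of them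
  suffices, and locally uniform limits are holomorphic.\<close>

lemma dirichlet_series_half_plane:
  fixes a :: "nat \<Rightarrow> complex" and K :: "nat \<Rightarrow> real"
  assumes A: "\<And>p n. norm (\<Sum>m<n. a m) \<le> K p * real n powr (\<alpha> + 1 / real (Suc p))" and "0 \<le> \<alpha>"
  shows dirichlet_series_sums: "\<alpha> < Re s \<Longrightarrow>
      (\<lambda>N. \<Sum>n<N. a n * of_nat (Suc n) powr (-s)) \<longlonglongrightarrow> (\<Sum>n. a n * of_nat (Suc n) powr (-s))"
    and dirichlet_series_holomorphic: "(\<lambda>s. \<Sum>n. a n * of_nat (Suc n) powr (-s)) holomorphic_on {s. \<alpha> < Re s}"
proof -
  have *: "\<exists>d>0. cball w d \<subseteq> {s. \<alpha> < Re s} \<and> uniform_limit (cball w d)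
      (\<lambda>N s. \<Sum>n<N. a n * of_nat (Suc n) powr (-s)) (\<lambda>s. \<Sum>n. a n * of_nat (Suc n) powr (-s)) sequentially"
    if w: "\<alpha> < Re w" for w
  proof -
    obtain p where p: "1 / real (Suc p) < Re w - \<alpha>"
      using w nat_approx_posE[of "Re w - \<alpha>"] by auto
    define d where "d = (Re w - (\<alpha> + 1 / real (Suc p))) / 2"
    have "0 < d" using p by (simp add: d_def)
    moreover have "cball w d \<subseteq> {s. \<alpha> < Re s}"
    proof
      fix s assume "s \<in> cball w d"
      then have "\<bar>Re w - Re s\<bar> \<le> d" using abs_Re_le_cmod[of "w - s"] by (simp add: dist_norm)
      moreover have "0 < 1 / real (Suc p)" by simp
      then have "d < Re w - \<alpha>" using \<open>0 < d\<close> unfolding d_def by argo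
      ultimately show "s \<in> {s. \<alpha> < Re s}" by auto
    qed
    moreover have "uniform_limit (cball w d)
      (\<lambda>N s. \<Sum>n<N. a n * of_nat (Suc n) powr (-s)) (\<lambda>s. \<Sum>n. a n * of_nat (Suc n) powr (-s)) sequentially"
      unfolding d_def using p \<open>0 \<le> \<alpha>\<close> by (intro dirichlet_series_uniform_limit[OF A]) auto
    ultimately show ?thesis by blast
  qed
  show "\<alpha> < Re s \<Longrightarrow>
      (\<lambda>N. \<Sum>n<N. a n * of_nat (Suc n) powr (-s)) \<longlonglongrightarrow> (\<Sum>n. a n * of_nat (Suc n) powr (-s))"
    using *[of s] by (auto intro: tendsto_uniform_limitI)
  show "(\<lambda>s. \<Sum>n. a n * of_nat (Suc n) powr (-s)) holomorphic_on {s. \<alpha> < Re s}"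
    by (rule holomorphic_uniform_sequence[where f = "\<lambda>N s. \<Sum>n<N. a n * of_nat (Suc n) powr (-s)"])
      (use * in \<open>auto intro!: open_halfspace_Re_gt holomorphic_intros simp del: of_nat_Suc\<close>)
qed

subsection \<open>Linear combinations of Gaussians\<close>

text \<open>The singularity of order 1/2 at the origin is integrable. There the density is at most
  1, and away from it \<open>\<bar>y\<bar> powr (-1/2)\<close> is at most 1. The value 10 is
  \<open>2 * (1 + 2 + 2)\<close>, with the factor 2 coming from \<open>sqrt \<sigma>\<close> being
  at least 1/2.\<close>

lemma inverse_sqrt_normal_moment:
  assumes "1/2 \<le> \<sigma>"
  shows "(\<integral>\<^sup>+y. ennreal (std_normal_density y) * inverse (ennreal (sqrt \<bar>\<sigma> * y\<bar>)) \<partial>lborel) \<le> 10"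
proof -
  have I1: "((\<lambda>y::real. y powr (-1/2)) has_integral 2) {0..1}"
    using has_integral_powr_from_0[of "-1/2" 1] by simp
  then have I2: "((\<lambda>y::real. (- y) powr (-1/2)) has_integral 2) {-1..0}"
    using has_integral_reflect_real[where f = "\<lambda>y::real. y powr (-1/2)" and a = 0 and b = 1 and i = 2] by simp
  have bound: "ennreal (std_normal_density y) * inverse (ennreal (sqrt \<bar>\<sigma> * y\<bar>))
      \<le> 2 * (ennreal (std_normal_density y) + (ennreal (y powr (-1/2)) * indicator {0..1} y
        + ennreal ((- y) powr (-1/2)) * indicator {-1..0} y))" if "y \<noteq> 0" for y
  proof -
    have "sqrt (1/4) \<le> sqrt \<sigma>" using assms by (intro real_sqrt_le_mono) auto
    then have s: "1/2 \<le> sqrt \<sigma>" by (simp add: real_sqrt_divide)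
    then have "sqrt \<bar>y\<bar> / 2 \<le> sqrt \<bar>\<sigma> * y\<bar>"
      using assms mult_right_mono[OF s, of "sqrt \<bar>y\<bar>"] by (simp add: abs_mult real_sqrt_mult)
    then have "inverse (sqrt \<bar>\<sigma> * y\<bar>) \<le> inverse (sqrt \<bar>y\<bar> / 2)"
      using that by (intro le_imp_inverse_le) auto
    also have "\<dots> = 2 * \<bar>y\<bar> powr (-1/2)"
      using that by (simp add: powr_minus powr_half_sqrt field_simps)
    finally have 1: "inverse (sqrt \<bar>\<sigma> * y\<bar>) \<le> 2 * \<bar>y\<bar> powr (-1/2)" .
    have "std_normal_density y \<le> 1 / sqrt (2 * pi)"
      by (simp add: std_normal_density_def divide_right_mono)
    also have "\<dots> \<le> 1"
      using pi_gt3 by simp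
    finally have 2: "std_normal_density y \<le> 1" .
    have 3: "std_normal_density y * \<bar>y\<bar> powr (-1/2)
        \<le> std_normal_density y + (y powr (-1/2) * indicator {0..1} y + (- y) powr (-1/2) * indicator {-1..0} y)"
    proof (cases "\<bar>y\<bar> \<le> 1")
      case True
      have "std_normal_density y * \<bar>y\<bar> powr (-1/2) \<le> 1 * \<bar>y\<bar> powr (-1/2)"
        using 2 by (intro mult_right_mono) auto
      moreover have "\<bar>y\<bar> powr (-1/2) = y powr (-1/2) * indicator {0..1} y + (- y) powr (-1/2) * indicator {-1..0} y"
        using True that by (cases "0 < y") (auto simp: indicator_def)
      ultimately show ?thesis by (simp add: add_increasing)
    next
      case False
      then have "\<bar>y\<bar> powr (-1/2) \<le> \<bar>y\<bar> powr 0" by (intro powr_mono) auto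
      then have "std_normal_density y * \<bar>y\<bar> powr (-1/2) \<le> std_normal_density y * 1"
        using that by (intro mult_left_mono) auto
      then show ?thesis by (simp add: add_increasing2)
    qed
    have "std_normal_density y * inverse (sqrt \<bar>\<sigma> * y\<bar>) \<le> 2 * (std_normal_density y * \<bar>y\<bar> powr (-1/2))"
      using mult_left_mono[OF 1, of "std_normal_density y"] by (simp add: mult_ac)
    from order_trans[OF this mult_left_mono[OF 3, of 2]]
    have 4: "std_normal_density y * inverse (sqrt \<bar>\<sigma> * y\<bar>) \<le> 2 * (std_normal_density y +
        (y powr (-1/2) * indicator {0..1} y + (- y) powr (-1/2) * indicator {-1..0} y))"
      by simp
    have "0 < sqrt \<bar>\<sigma> * y\<bar>" using that assms by simp
    then have "ennreal (std_normal_density y) * inverse (ennreal (sqrt \<bar>\<sigma> * y\<bar>))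
        = ennreal (std_normal_density y * inverse (sqrt \<bar>\<sigma> * y\<bar>))"
      by (simp add: inverse_ennreal ennreal_mult)
    also have "\<dots> \<le> ennreal (2 * (std_normal_density y +
        (y powr (-1/2) * indicator {0..1} y + (- y) powr (-1/2) * indicator {-1..0} y)))"
      using 4 by (rule ennreal_leI)
    also have "\<dots> = 2 * (ennreal (std_normal_density y) + (ennreal (y powr (-1/2)) * indicator {0..1} y
        + ennreal ((- y) powr (-1/2)) * indicator {-1..0} y))"
      by (simp add: ennreal_mult' ennreal_plus ennreal_indicator)
    finally show ?thesis .
  qed
  have "(\<integral>\<^sup>+y. ennreal (std_normal_density y) * inverse (ennreal (sqrt \<bar>\<sigma> * y\<bar>)) \<partial>lborel)
    \<le> (\<integral>\<^sup>+y. 2 * (ennreal (std_normal_density y) + (ennreal (y powr (-1/2)) * indicator {0..1} y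
        + ennreal ((- y) powr (-1/2)) * indicator {-1..0} y)) \<partial>lborel)"
    \<comment> \<open>At \<open>y = 0\<close> the comparison fails, since the inverse is infinite
      while \<open>0 powr (-1/2)\<close> is 0; hence it is used almost everywhere.\<close>
    using bound AE_lborel_singleton[of 0] by (intro nn_integral_mono_AE) auto
  also have "\<dots> = 2 * ((\<integral>\<^sup>+y. ennreal (std_normal_density y) \<partial>lborel)
      + ((\<integral>\<^sup>+y. ennreal (y powr (-1/2)) * indicator {0..1} y \<partial>lborel)
        + (\<integral>\<^sup>+y. ennreal ((- y) powr (-1/2)) * indicator {-1..0} y \<partial>lborel)))"
    by (simp add: nn_integral_cmult nn_integral_add)
  also have "(\<integral>\<^sup>+y. ennreal (std_normal_density y) \<partial>lborel) = 1"
    using prob_space.emeasure_space_1[OF prob_space_normal_density, of 1 0]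
    by (simp add: emeasure_density)
  also have "(\<integral>\<^sup>+y. ennreal (y powr (-1/2)) * indicator {0..1} y \<partial>lborel) = ennreal 2"
    by (rule nn_integral_has_integral_lebesgue'[OF _ I1]) simp
  also have "(\<integral>\<^sup>+y. ennreal ((- y) powr (-1/2)) * indicator {-1..0} y \<partial>lborel) = ennreal 2"
    by (rule nn_integral_has_integral_lebesgue'[OF _ I2]) simp
  also have "2 * (1 + (ennreal 2 + ennreal 2)) = 10"
    by (simp flip: numeral_One ennreal_numeral ennreal_plus ennreal_mult)
  finally show ?thesis by simp
qed

lemma nn_integral_std_normal_power_even:
  "(\<integral>\<^sup>+y. ennreal (std_normal_density y) * ennreal (y ^ (2 * p)) \<partial>lborel) = ennreal (fact (2 * p) / (2 ^ p * fact p))"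
proof -
  have "(\<integral>\<^sup>+y. ennreal (std_normal_density y * y ^ (2 * p)) \<partial>lborel)
      = ennreal (integral\<^sup>L lborel (\<lambda>y. std_normal_density y * y ^ (2 * p)))"
    using std_normal_moment_even[of p] by (intro nn_integral_eq_integral) (auto simp: has_bochner_integral_iff)
  then show ?thesis
    by (simp add: integral_std_normal_moment_even ennreal_mult')
qed

locale gaussian_sequence = prob_space M for M :: "'a measure" +
  fixes X :: "nat \<Rightarrow> 'a \<Rightarrow> real"
  assumes indep: "indep_vars (\<lambda>_. borel) X {1..}"
    and normal: "\<And>n. n \<ge> 1 \<Longrightarrow> distributed M lborel (X n) std_normal_density"
begin

lemma measurable_X [measurable]: "X (Suc n) \<in> borel_measurable M"
  using distributed_measurable[OF normal[of "Suc n"]] by simp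

text \<open>Independent Gaussians add up to a Gaussian whose variance is the sum of the squares.
  Keeping \<open>g\<close> general lets the same formula serve both the even moments and the inverse
  square root.\<close>

lemma nn_integral_linear_combination:
  fixes g :: "real \<Rightarrow> ennreal"
  assumes [measurable]: "g \<in> borel_measurable borel"
  shows "(\<integral>\<^sup>+\<omega>. g (\<Sum>n<N. c n * X (Suc n) \<omega>) \<partial>M)
    = (\<integral>\<^sup>+y. ennreal (std_normal_density y) * g (sqrt (\<Sum>n<N. (c n)\<^sup>2) * y) \<partial>lborel)"
proof -
  \<comment> \<open>Zero coefficients are dropped because the summands must have positive standard
    deviation; if none remain, both sides equal \<open>g 0\<close>.\<close>
  define I where "I = {n\<in>{1..N}. c (n - 1) \<noteq> 0}"
  define \<sigma> where "\<sigma> = sqrt (\<Sum>n<N. (c n)\<^sup>2)"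
  define Z where "Z = (\<lambda>\<omega>. \<Sum>n\<in>I. c (n - 1) * X n \<omega>)"
  have Z: "(\<Sum>n<N. c n * X (Suc n) \<omega>) = Z \<omega>" for \<omega>
  proof -
    have "(\<Sum>n<N. c n * X (Suc n) \<omega>) = (\<Sum>n\<in>{1..N}. c (n - 1) * X n \<omega>)"
      by (simp add: sum.atLeast1_atMost_eq)
    also have "\<dots> = Z \<omega>"
      unfolding Z_def I_def by (rule sum.mono_neutral_right) auto
    finally show ?thesis .
  qed
  have \<sigma>: "\<sigma> = sqrt (\<Sum>n\<in>I. \<bar>c (n - 1)\<bar>\<^sup>2)"
  proof -
    have "(\<Sum>n<N. (c n)\<^sup>2) = (\<Sum>n\<in>{1..N}. \<bar>c (n - 1)\<bar>\<^sup>2)"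
      by (simp add: sum.atLeast1_atMost_eq)
    also have "\<dots> = (\<Sum>n\<in>I. \<bar>c (n - 1)\<bar>\<^sup>2)"
      unfolding I_def by (rule sum.mono_neutral_right) auto
    finally show ?thesis by (simp add: \<sigma>_def)
  qed
  show ?thesis
  proof (cases "I = {}")
    case True
    then have "Z = (\<lambda>_. 0)" "\<sigma> = 0" by (auto simp: Z_def \<sigma>)
    moreover have "(\<integral>\<^sup>+y. ennreal (std_normal_density y) \<partial>lborel) = 1"
      using prob_space.emeasure_space_1[OF prob_space_normal_density, of 1 0] by (simp add: emeasure_density)
    ultimately show ?thesis
      unfolding Z \<sigma>_def[symmetric] by (simp add: emeasure_space_1 nn_integral_multc)
  next
    case False
    have "finite I" by (simp add: I_def)
    have "(\<Sum>n\<in>I. \<bar>c (n - 1)\<bar>\<^sup>2) > 0"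
      using False \<open>finite I\<close> by (intro sum_pos) (auto simp: I_def)
    then have "0 < \<sigma>" by (simp add: \<sigma>)
    have "distributed M lborel (\<lambda>\<omega>. \<Sum>n\<in>I. c (n - 1) * X n \<omega>)
        (normal_density (\<Sum>n\<in>I. 0) (sqrt (\<Sum>n\<in>I. \<bar>c (n - 1)\<bar>\<^sup>2)))"
    proof (rule sum_indep_normal)
      show "indep_vars (\<lambda>_. borel) (\<lambda>n \<omega>. c (n - 1) * X n \<omega>) I"
        by (rule indep_vars_compose2[where Y = "\<lambda>n x. c (n - 1) * x", OF indep_vars_subset[OF indep]])
          (auto simp: I_def)
      show "distributed M lborel (\<lambda>\<omega>. c (n - 1) * X n \<omega>) (normal_density 0 \<bar>c (n - 1)\<bar>)" if "n \<in> I" for n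
        using that normal_density_affine[OF normal[of n], of "c (n - 1)" 0] by (auto simp: I_def)
    qed (use False \<open>finite I\<close> in \<open>auto simp: I_def\<close>)
    then have "distributed M lborel Z (normal_density 0 \<sigma>)"
      by (simp add: \<sigma> Z_def)
    then have "distributed M lborel (\<lambda>\<omega>. (Z \<omega> - 0) / \<sigma>) std_normal_density"
      using normal_standard_normal_convert[OF \<open>0 < \<sigma>\<close>] by blast
    from distributed_nn_integral[OF this, of "\<lambda>y. g (\<sigma> * y)"] show ?thesis
      unfolding Z \<sigma>_def[symmetric] using \<open>0 < \<sigma>\<close> by simp
  qed
qed

lemma nn_integral_linear_combination_power_even:
  "(\<integral>\<^sup>+\<omega>. ennreal ((\<Sum>n<N. c n * X (Suc n) \<omega>) ^ (2 * p)) \<partial>M)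
    = ennreal (fact (2 * p) / (2 ^ p * fact p) * (\<Sum>n<N. (c n)\<^sup>2) ^ p)"
proof -
  have sq: "(sqrt (\<Sum>n<N. (c n)\<^sup>2) * y) ^ (2 * p) = (\<Sum>n<N. (c n)\<^sup>2) ^ p * y ^ (2 * p)" for y
    by (simp add: power_mult_distrib power_mult[of "sqrt _"] sum_nonneg)
  have "(\<integral>\<^sup>+\<omega>. ennreal ((\<Sum>n<N. c n * X (Suc n) \<omega>) ^ (2 * p)) \<partial>M)
      = (\<integral>\<^sup>+y. ennreal ((\<Sum>n<N. (c n)\<^sup>2) ^ p) * (ennreal (std_normal_density y) * ennreal (y ^ (2 * p))) \<partial>lborel)"
    by (subst nn_integral_linear_combination)
      (auto intro!: nn_integral_cong simp: sq sum_nonneg ennreal_mult mult.left_commute)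
  also have "\<dots> = ennreal ((\<Sum>n<N. (c n)\<^sup>2) ^ p) * ennreal (fact (2 * p) / (2 ^ p * fact p))"
    by (simp add: nn_integral_cmult nn_integral_std_normal_power_even)
  finally show ?thesis
    by (simp add: ennreal_mult'[symmetric] mult.commute sum_nonneg)
qed

text \<open>The moment of order \<open>2 * q\<close> of a sum of \<open>n\<close> terms is a
  constant times \<open>n ^ q\<close>. Divided by \<open>n ^ (q + 2)\<close> it is summable, so
  almost surely the sum of the quotients is finite and bounds each of them; a root of order
  \<open>2 * q\<close> gives the exponent \<open>1/2 + 1 / q\<close>.\<close>

lemma AE_partial_sums_bound:
  "AE \<omega> in M. \<exists>K. \<forall>n. \<bar>\<Sum>m<n. X (Suc m) \<omega>\<bar> \<le> K * real n powr (1/2 + 1 / real (Suc p))"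
proof -
  define q where "q = Suc p"
  define V where "V n \<omega> = (\<Sum>m<n. X (Suc m) \<omega>)" for n \<omega>
  define D :: real where "D = fact (2 * q) / (2 ^ q * fact q)"
  define Q where "Q n \<omega> = ennreal (V (Suc n) \<omega> ^ (2 * q) / real (Suc n) ^ (q + 2))" for n \<omega>
  have [measurable]: "V n \<in> borel_measurable M" "Q n \<in> borel_measurable M" for n
    unfolding V_def Q_def by measurable
  have Q: "(\<integral>\<^sup>+\<omega>. Q n \<omega> \<partial>M) = ennreal (D / real (Suc n) ^ 2)" for n
  proof -
    have "(\<integral>\<^sup>+\<omega>. Q n \<omega> \<partial>M) = (\<integral>\<^sup>+\<omega>. ennreal (1 / real (Suc n) ^ (q + 2)) * ennreal (V (Suc n) \<omega> ^ (2 * q)) \<partial>M)"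
      unfolding Q_def by (intro nn_integral_cong) (simp flip: ennreal_mult')
    also have "\<dots> = ennreal (1 / real (Suc n) ^ (q + 2)) * ennreal (D * real (Suc n) ^ q)"
      using nn_integral_linear_combination_power_even[where N = "Suc n" and c = "\<lambda>_. 1" and p = q]
      by (simp add: nn_integral_cmult V_def D_def del: sum.lessThan_Suc)
    also have "\<dots> = ennreal (D / real (Suc n) ^ 2)"
      by (simp add: ennreal_mult'[symmetric] power_add power2_eq_square del: of_nat_Suc)
    finally show ?thesis .
  qed
  have "(\<integral>\<^sup>+\<omega>. (\<Sum>n. Q n \<omega>) \<partial>M) = (\<Sum>n. ennreal (D / real (Suc n) ^ 2))"
    by (simp add: nn_integral_suminf Q)
  also have "\<dots> = ennreal (\<Sum>n. D * (1 / real (Suc n) ^ 2))"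
    using summable_mult[OF inverse_squares_sums[THEN sums_summable], of D]
    by (subst suminf_ennreal2) (auto simp: D_def add_ac)
  also have "\<dots> < \<infinity>" by simp
  finally have "AE \<omega> in M. (\<Sum>n. Q n \<omega>) \<noteq> \<infinity>"
    by (intro nn_integral_noteq_infinite) auto
  then show ?thesis
  proof eventually_elim
    fix \<omega> assume fin: "(\<Sum>n. Q n \<omega>) \<noteq> \<infinity>"
    \<comment> \<open>Being at least 1 gives \<open>L \<le> L ^ (2 * q)\<close>, so that the root
      can be taken on both sides.\<close>
    define L where "L = max 1 (enn2real (\<Sum>n. Q n \<omega>))"
    have "\<bar>V n \<omega>\<bar> \<le> L * real n powr (1/2 + 1 / real q)" for n
    proof (cases n)
      case 0
      then show ?thesis by (simp add: V_def)
    next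
      case (Suc k)
      have pw: "(real n powr (1/2 + 1 / real q)) ^ (2 * q) = real n ^ (q + 2)"
      proof -
        have "(real n powr (1/2 + 1 / real q)) ^ (2 * q) = real n powr ((1/2 + 1 / real q) * real (2 * q))"
          using Suc by (simp add: powr_powr flip: powr_realpow)
        also have "(1/2 + 1 / real q) * real (2 * q) = real (q + 2)"
          by (simp add: q_def field_simps)
        finally show ?thesis using Suc by (simp only: powr_realpow)
      qed
      have "Q k \<omega> \<le> (\<Sum>n. Q n \<omega>)"
        using sum_le_suminf[of "\<lambda>n. Q n \<omega>" "{k}"] by simp
      also have "\<dots> \<le> ennreal L"
        using fin by (metis L_def ennreal_enn2real ennreal_leI infinity_ennreal_def max.cobounded2 top.not_eq_extremum)
      finally have "V n \<omega> ^ (2 * q) / real n ^ (q + 2) \<le> L"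
        unfolding Q_def Suc[symmetric] by (subst (asm) ennreal_le_iff) (auto simp: L_def)
      then have "\<bar>V n \<omega>\<bar> ^ (2 * q) \<le> L * real n ^ (q + 2)"
        using Suc by (simp add: pos_divide_le_eq power_even_abs del: of_nat_Suc)
      also have "\<dots> \<le> L ^ (2 * q) * real n ^ (q + 2)"
        using power_increasing[of 1 "2 * q" L] by (intro mult_right_mono) (auto simp: L_def q_def)
      also have "\<dots> = (L * real n powr (1/2 + 1 / real q)) ^ (2 * q)"
        by (simp add: power_mult_distrib pw)
      finally show ?thesis
        by (subst (asm) power_mono_iff) (auto simp: q_def L_def)
    qed
    then show "\<exists>K. \<forall>n. \<bar>\<Sum>m<n. X (Suc m) \<omega>\<bar> \<le> K * real n powr (1/2 + 1 / real (Suc p))"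
      unfolding V_def q_def by blast
  qed
qed

section \<open>Almost sure holomorphic extension of the random series\<close>

definition partial_sum :: "'a \<Rightarrow> nat \<Rightarrow> complex \<Rightarrow> complex" where
  "partial_sum \<omega> N s = (\<Sum>n<N. of_real (X (Suc n) \<omega>) * of_nat (Suc n) powr (-s))"

definition dirichlet :: "'a \<Rightarrow> complex \<Rightarrow> complex" where
  "dirichlet \<omega> s = (\<Sum>n. of_real (X (Suc n) \<omega>) * of_nat (Suc n) powr (-s))"

text \<open>Intersecting over the countably many \<open>p\<close> leaves one null set that works for
  all \<open>s\<close> simultaneously; outside it the deterministic convergence result applies with
  abscissa 1/2.\<close>

lemma AE_dirichlet:
  "AE \<omega> in M. dirichlet \<omega> holomorphic_on {s. 1/2 < Re s} \<and>
    (\<forall>s. 1/2 < Re s \<longrightarrow> (\<lambda>N. partial_sum \<omega> N s) \<longlonglongrightarrow> dirichlet \<omega> s)"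
proof -
  have "AE \<omega> in M. \<forall>p. \<exists>K. \<forall>n. \<bar>\<Sum>m<n. X (Suc m) \<omega>\<bar> \<le> K * real n powr (1/2 + 1 / real (Suc p))"
    using AE_partial_sums_bound by (simp add: AE_all_countable)
  then show ?thesis
  proof eventually_elim
    fix \<omega> assume "\<forall>p. \<exists>K. \<forall>n. \<bar>\<Sum>m<n. X (Suc m) \<omega>\<bar> \<le> K * real n powr (1/2 + 1 / real (Suc p))"
    then obtain K where "\<bar>\<Sum>m<n. X (Suc m) \<omega>\<bar> \<le> K p * real n powr (1/2 + 1 / real (Suc p))" for p n
      by metis
    then have *: "norm (\<Sum>m<n. complex_of_real (X (Suc m) \<omega>)) \<le> K p * real n powr (1/2 + 1 / real (Suc p))" for p n
      by (simp flip: of_real_sum)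
    show "dirichlet \<omega> holomorphic_on {s. 1/2 < Re s} \<and>
        (\<forall>s. 1/2 < Re s \<longrightarrow> (\<lambda>N. partial_sum \<omega> N s) \<longlonglongrightarrow> dirichlet \<omega> s)"
      unfolding dirichlet_def partial_sum_def
      using dirichlet_series_half_plane[OF *] by simp
  qed
qed

end

subsection \<open>Moments on the circle and at its center\<close>

lemma powr_minus_Suc_diff_bounds:
  fixes x b :: real
  assumes "0 < x" "0 < b"
  shows "b * (x + 1) powr (- 1 - b) \<le> x powr (-b) - (x + 1) powr (-b)"
    and "x powr (-b) - (x + 1) powr (-b) \<le> b * x powr (- 1 - b)"
proof -
  have "\<exists>z>x. z < x + 1 \<and> (x + 1) powr (-b) - x powr (-b) = (x + 1 - x) * (- b * z powr (- b - 1))"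
    using assms by (intro MVT2) (auto intro!: derivative_eq_intros)
  then obtain z where z: "x < z" "z < x + 1" "(x + 1) powr (-b) - x powr (-b) = - b * z powr (- b - 1)"
    by auto
  have "- b - 1 = - 1 - b" by simp
  with z(3) have z': "x powr (-b) - (x + 1) powr (-b) = b * z powr (- 1 - b)"
    by simp
  show "b * (x + 1) powr (- 1 - b) \<le> x powr (-b) - (x + 1) powr (-b)"
    unfolding z' using assms z by (intro mult_left_mono powr_mono2') auto
  show "x powr (-b) - (x + 1) powr (-b) \<le> b * x powr (- 1 - b)"
    unfolding z' using assms z by (intro mult_left_mono powr_mono2') auto
qed

text \<open>A discrete integral test: the differences of \<open>x powr (-b)\<close> telescope. The
  upper bound serves the variance on the circle, the lower one the variance at the center.\<close>

lemma sum_powr_bounds: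
  fixes b :: real
  assumes "0 < b"
  shows "(\<Sum>n<N. real (Suc n) powr (- 1 - b)) \<le> 1 + 1 / b"
    and "(1 - real (Suc N) powr (-b)) / b \<le> (\<Sum>n<N. real (Suc n) powr (- 1 - b))"
proof -
  \<comment> \<open>A difference dominates the term at its right end only, so the first term, equal
    to 1, is split off.\<close>
  have "(\<Sum>n<Suc N. real (Suc n) powr (- 1 - b)) \<le> 1 + (1 - real (Suc N) powr (-b)) / b" for N
  proof (induction N)
    case (Suc N)
    have "real (Suc (Suc N)) powr (- 1 - b) \<le> (real (Suc N) powr (-b) - real (Suc (Suc N)) powr (-b)) / b"
      using powr_minus_Suc_diff_bounds(1)[of "real (Suc N)" b] assms
      by (simp add: field_simps)
    then show ?case
      using Suc by (simp add: diff_divide_distrib)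
  qed simp
  moreover have "(1 - real (Suc N) powr (-b)) / b \<le> 1 / b" for N
    using assms by (intro divide_right_mono) auto
  moreover have "(\<Sum>n<N. real (Suc n) powr (- 1 - b)) \<le> (\<Sum>n<Suc N. real (Suc n) powr (- 1 - b))"
    by (simp del: of_nat_Suc)
  ultimately show "(\<Sum>n<N. real (Suc n) powr (- 1 - b)) \<le> 1 + 1 / b"
    by (meson add_left_mono order_trans)
  show "(1 - real (Suc N) powr (-b)) / b \<le> (\<Sum>n<N. real (Suc n) powr (- 1 - b))"
  proof (induction N)
    case (Suc N)
    have "(real (Suc N) powr (-b) - real (Suc (Suc N)) powr (-b)) / b \<le> real (Suc N) powr (- 1 - b)"
      using powr_minus_Suc_diff_bounds(2)[of "real (Suc N)" b] assms
      by (simp add: field_simps)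
    then show ?case
      using Suc by (simp add: diff_divide_distrib)
  qed simp
qed

context gaussian_sequence
begin

lemma measurable_partial_sum [measurable]: "(\<lambda>\<omega>. partial_sum \<omega> N s) \<in> borel_measurable M"
  unfolding partial_sum_def by measurable

lemma partial_sum_of_real:
  "partial_sum \<omega> N (of_real \<sigma>) = of_real (\<Sum>n<N. X (Suc n) \<omega> * real (Suc n) powr (- \<sigma>))"
proof -
  have "of_nat (Suc n) powr (- complex_of_real \<sigma>) = of_real (real (Suc n) powr (- \<sigma>))" for n
    using powr_of_real[of "real (Suc n)" "- \<sigma>"] by (simp del: of_nat_Suc)
  then show ?thesis
    unfolding partial_sum_def of_real_sum of_real_mult by simp
qed

text \<open>Since the \<open>X n\<close> are real, the real and imaginary parts are each linear
  combinations of them, and their second moments just add.\<close>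

lemma second_moment_partial_sum:
  "(\<integral>\<^sup>+\<omega>. ennreal ((norm (partial_sum \<omega> N s))\<^sup>2) \<partial>M) = ennreal (\<Sum>n<N. real (Suc n) powr (- 2 * Re s))"
proof -
  define u where "u n = of_nat (Suc n) powr (-s)" for n
  have "(norm (partial_sum \<omega> N s))\<^sup>2 = (\<Sum>n<N. Re (u n) * X (Suc n) \<omega>)\<^sup>2 + (\<Sum>n<N. Im (u n) * X (Suc n) \<omega>)\<^sup>2" for \<omega>
    by (simp add: cmod_power2 partial_sum_def u_def mult.commute)
  then have "(\<integral>\<^sup>+\<omega>. ennreal ((norm (partial_sum \<omega> N s))\<^sup>2) \<partial>M)
      = (\<integral>\<^sup>+\<omega>. ennreal ((\<Sum>n<N. Re (u n) * X (Suc n) \<omega>)\<^sup>2) \<partial>M) + (\<integral>\<^sup>+\<omega>. ennreal ((\<Sum>n<N. Im (u n) * X (Suc n) \<omega>)\<^sup>2) \<partial>M)"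
    by (simp add: nn_integral_add)
  also have "\<dots> = ennreal (\<Sum>n<N. (Re (u n))\<^sup>2) + ennreal (\<Sum>n<N. (Im (u n))\<^sup>2)"
    using nn_integral_linear_combination_power_even[where p = 1] by simp
  also have "\<dots> = ennreal (\<Sum>n<N. (norm (u n))\<^sup>2)"
    by (simp add: cmod_power2 sum.distrib sum_nonneg)
  also have "(\<lambda>n. (norm (u n))\<^sup>2) = (\<lambda>n. real (Suc n) powr (- 2 * Re s))"
  proof
    fix n
    have "norm (u n) = real (Suc n) powr (- Re s)"
      by (simp add: u_def norm_powr_real_powr del: of_nat_Suc)
    then show "(norm (u n))\<^sup>2 = real (Suc n) powr (- 2 * Re s)"
      by (simp add: power2_eq_square flip: powr_add del: of_nat_Suc)
  qed
  finally show ?thesis .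
qed

text \<open>The midpoint of the interval from \<open>1/2 + a\<close> to \<open>1/2 + 2 * a\<close>,
  whose half-length is \<open>a / 2\<close>.\<close>

definition center :: "real \<Rightarrow> complex" where
  "center a = of_real (1/2 + 3 * a / 2)"

text \<open>The radius must exceed \<open>a\<close>, for the ratio \<open>(R - r) / r\<close> with
  \<open>r = a / 2\<close> to be above 1, and stay below \<open>3 * a / 2\<close>, the distance to
  the line \<open>Re s = 1/2\<close>. The value halfway gives ratio 3/2 and leaves a margin
  \<open>a / 4\<close>.\<close>

definition circle :: "real \<Rightarrow> real \<Rightarrow> complex" where
  "circle a = circlepath (center a) (5 * a / 4)"

text \<open>
  The next two quantities are the mean of \<open>\<bar>F\<bar>\<^sup>2\<close> over the circle and \<open>\<bar>F\<bar>\<^bsup>-1/2\<^esup>\<close> at its center, with \<open>F\<close>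
  normalised by its standard deviation, of order \<open>a\<^bsup>-1/2\<^esup>\<close>. With \<open>liminf\<close> of partial sums they are measurable and
  Fatou's lemma applies; \<open>center_value\<close> is infinite when \<open>F\<close> vanishes at the center.
\<close>

definition circle_mean :: "real \<Rightarrow> 'a \<Rightarrow> ennreal" where
  "circle_mean a \<omega> = (\<integral>\<^sup>+t. liminf (\<lambda>N. ennreal (a * (norm (partial_sum \<omega> N (circle a t)))\<^sup>2)) * indicator {0..1} t \<partial>lborel)"

definition center_value :: "real \<Rightarrow> 'a \<Rightarrow> ennreal" where
  "center_value a \<omega> = liminf (\<lambda>N. inverse (ennreal (sqrt (sqrt a * norm (partial_sum \<omega> N (center a))))))"

lemma continuous_on_circle: "continuous_on A (circle a)"
  unfolding circle_def circlepath by (intro continuous_intros)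

lemma Re_circle_ge:
  assumes "0 < a"
  shows "1/2 + a/4 \<le> Re (circle a t)"
proof -
  have "norm (circle a t - center a) = 5 * a / 4"
    using assms by (simp add: circle_def circlepath norm_mult)
  then show ?thesis
    using abs_Re_le_cmod[of "circle a t - center a"] by (simp add: center_def)
qed

lemma measurable_partial_sum_circle [measurable]:
  "(\<lambda>x. partial_sum (fst x) N (circle a (snd x))) \<in> borel_measurable (M \<Otimes>\<^sub>M lborel)"
proof -
  have [measurable]: "(\<lambda>t. of_nat (Suc n) powr (- circle a t)) \<in> borel_measurable borel" for n
    by (intro borel_measurable_continuous_onI continuous_intros continuous_on_circle)
      (use of_nat_neq_0 in auto)
  show ?thesis
    unfolding partial_sum_def by measurable
qed

lemma measurable_circle_mean [measurable]: "circle_mean a \<in> borel_measurable M"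
  unfolding circle_mean_def
  by (rule lborel.borel_measurable_nn_integral) (simp add: case_prod_beta, measurable)

lemma measurable_center_value [measurable]: "center_value a \<in> borel_measurable M"
  unfolding center_value_def by measurable

text \<open>Fubini, then Fatou at each \<open>t\<close>: on the circle the second moment of a
  partial sum is at most \<open>1 + 2 / a\<close>, and
  \<open>a * (1 + 2 / a) \<le> 3\<close>.\<close>

lemma nn_integral_circle_mean:
  assumes a: "0 < a" "a \<le> 1"
  shows "(\<integral>\<^sup>+\<omega>. circle_mean a \<omega> \<partial>M) \<le> 3"
proof -
  interpret pair_sigma_finite M lborel ..
  have "(\<integral>\<^sup>+\<omega>. circle_mean a \<omega> \<partial>M)
    = (\<integral>\<^sup>+t. \<integral>\<^sup>+\<omega>. liminf (\<lambda>N. ennreal (a * (norm (partial_sum \<omega> N (circle a t)))\<^sup>2)) * indicator {0..1} t \<partial>M \<partial>lborel)"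
    unfolding circle_mean_def
    by (rule Fubini'[symmetric]) (simp add: case_prod_beta, measurable)
  also have "\<dots> \<le> (\<integral>\<^sup>+t. 3 * indicator {0..1} t \<partial>(lborel :: real measure))"
  proof (rule nn_integral_mono)
    fix t :: real
    have "(\<integral>\<^sup>+\<omega>. ennreal (a * (norm (partial_sum \<omega> N (circle a t)))\<^sup>2) \<partial>M) \<le> 3" for N
    proof -
      have "(\<integral>\<^sup>+\<omega>. ennreal (a * (norm (partial_sum \<omega> N (circle a t)))\<^sup>2) \<partial>M)
          = ennreal (a * (\<Sum>n<N. real (Suc n) powr (- 2 * Re (circle a t))))"
        using a by (simp add: ennreal_mult' nn_integral_cmult second_moment_partial_sum)
      also have "\<dots> \<le> ennreal (a * (\<Sum>n<N. real (Suc n) powr (- 1 - a / 2)))"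
        using a Re_circle_ge[of a t] by (intro ennreal_leI mult_left_mono sum_mono powr_mono) auto
      also have "\<dots> \<le> ennreal (a * (1 + 1 / (a / 2)))"
        using a by (intro ennreal_leI mult_left_mono sum_powr_bounds) auto
      also have "\<dots> \<le> ennreal 3"
        using a by (intro ennreal_leI) (simp add: field_simps)
      finally show ?thesis by simp
    qed
    then have "liminf (\<lambda>N. \<integral>\<^sup>+\<omega>. ennreal (a * (norm (partial_sum \<omega> N (circle a t)))\<^sup>2) \<partial>M) \<le> 3"
      by (intro order_trans[OF Liminf_le_Limsup Limsup_bounded]) auto
    moreover have "(\<integral>\<^sup>+\<omega>. liminf (\<lambda>N. ennreal (a * (norm (partial_sum \<omega> N (circle a t)))\<^sup>2)) \<partial>M)
        \<le> liminf (\<lambda>N. \<integral>\<^sup>+\<omega>. ennreal (a * (norm (partial_sum \<omega> N (circle a t)))\<^sup>2) \<partial>M)"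
      by (rule nn_integral_liminf) measurable
    ultimately show "(\<integral>\<^sup>+\<omega>. liminf (\<lambda>N. ennreal (a * (norm (partial_sum \<omega> N (circle a t)))\<^sup>2)) * indicator {0..1} t \<partial>M)
        \<le> 3 * indicator {0..1} t"
      by (auto simp: indicator_def)
  qed
  also have "\<dots> = 3"
    by (simp add: nn_integral_cmult)
  finally show ?thesis .
qed

text \<open>For large \<open>N\<close> the normalised partial sum at the center is a Gaussian with
  variance bounded below independently of \<open>a\<close>, so its inverse square root has
  expectation at most 10; Fatou passes to the limit.\<close>

lemma nn_integral_center_value:
  assumes a: "0 < a"
  shows "(\<integral>\<^sup>+\<omega>. center_value a \<omega> \<partial>M) \<le> 10"
proof -
  define c where "c n = sqrt a * real (Suc n) powr (- (1/2 + 3 * a / 2))" for n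
  have P: "sqrt a * norm (partial_sum \<omega> N (center a)) = \<bar>\<Sum>n<N. c n * X (Suc n) \<omega>\<bar>" for \<omega> N
  proof -
    have "partial_sum \<omega> N (center a) = of_real (\<Sum>n<N. X (Suc n) \<omega> * real (Suc n) powr (- (1/2 + 3 * a / 2)))"
      unfolding center_def by (rule partial_sum_of_real)
    then have "sqrt a * norm (partial_sum \<omega> N (center a))
        = \<bar>sqrt a * (\<Sum>n<N. X (Suc n) \<omega> * real (Suc n) powr (- (1/2 + 3 * a / 2)))\<bar>"
      using a by (simp add: abs_mult del: of_nat_Suc of_real_sum)
    then show ?thesis
      by (simp add: c_def sum_distrib_left mult_ac del: of_nat_Suc)
  qed
  have c2: "(\<Sum>n<N. (c n)\<^sup>2) = a * (\<Sum>n<N. real (Suc n) powr (- 1 - 3 * a))" for N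
    unfolding sum_distrib_left
  proof (rule sum.cong)
    fix n
    have "(c n)\<^sup>2 = a * real (Suc n) powr (- (1/2 + 3 * a / 2) + - (1/2 + 3 * a / 2))"
      using a unfolding c_def powr_add by (simp add: power_mult_distrib power2_eq_square del: of_nat_Suc)
    also have "- (1/2 + 3 * a / 2) + - (1/2 + 3 * a / 2) = - 1 - 3 * a" by simp
    finally show "(c n)\<^sup>2 = a * real (Suc n) powr (- 1 - 3 * a)" .
  qed simp
  have "(\<lambda>N. real (Suc N) powr (- (3 * a))) \<longlonglongrightarrow> 0"
    using a by (intro tendsto_neg_powr filterlim_compose[OF filterlim_real_sequentially filterlim_Suc]) auto
  \<comment> \<open>With 1/4 as threshold the variance is at least
    \<open>(1 - 1/4) / 3 = 1/4\<close>, which is the standard deviation 1/2 required above.\<close>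
  then have "eventually (\<lambda>N. real (Suc N) powr (- (3 * a)) < 1/4) sequentially"
    by (rule order_tendstoD) simp
  then have "eventually (\<lambda>N. (\<integral>\<^sup>+\<omega>. inverse (ennreal (sqrt (sqrt a * norm (partial_sum \<omega> N (center a))))) \<partial>M) \<le> 10) sequentially"
  proof eventually_elim
    fix N assume N: "real (Suc N) powr (- (3 * a)) < 1/4"
    have "1/4 \<le> (1 - real (Suc N) powr (- (3 * a))) / 3"
      using N by simp
    also have "\<dots> = a * ((1 - real (Suc N) powr (- (3 * a))) / (3 * a))"
      using a by simp
    also have "\<dots> \<le> (\<Sum>n<N. (c n)\<^sup>2)"
      unfolding c2 using a by (intro mult_left_mono sum_powr_bounds(2)) auto
    finally have "sqrt (1/4) \<le> sqrt (\<Sum>n<N. (c n)\<^sup>2)"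
      by (rule real_sqrt_le_mono)
    then have "1/2 \<le> sqrt (\<Sum>n<N. (c n)\<^sup>2)"
      by (simp add: real_sqrt_divide)
    then show "(\<integral>\<^sup>+\<omega>. inverse (ennreal (sqrt (sqrt a * norm (partial_sum \<omega> N (center a))))) \<partial>M) \<le> 10"
      unfolding P using inverse_sqrt_normal_moment
      by (subst nn_integral_linear_combination[where g = "\<lambda>y. inverse (ennreal (sqrt \<bar>y\<bar>))"]) auto
  qed
  then have "liminf (\<lambda>N. \<integral>\<^sup>+\<omega>. inverse (ennreal (sqrt (sqrt a * norm (partial_sum \<omega> N (center a))))) \<partial>M) \<le> 10"
    by (intro order_trans[OF Liminf_le_Limsup Limsup_bounded]) auto
  moreover have "(\<integral>\<^sup>+\<omega>. center_value a \<omega> \<partial>M)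
      \<le> liminf (\<lambda>N. \<integral>\<^sup>+\<omega>. inverse (ennreal (sqrt (sqrt a * norm (partial_sum \<omega> N (center a))))) \<partial>M)"
    unfolding center_value_def by (rule nn_integral_liminf) measurable
  ultimately show ?thesis by (rule order_trans[rotated])
qed

subsection \<open>Counting zeros\<close>

lemma gauss_dirichlet_eq:
  assumes "(\<lambda>N. partial_sum \<omega> N (of_real \<sigma>)) \<longlonglongrightarrow> dirichlet \<omega> (of_real \<sigma>)"
  shows "dirichlet \<omega> (of_real \<sigma>) = of_real (gauss_dirichlet X \<omega> \<sigma>)"
proof -
  have "(\<lambda>N. \<Sum>n<N. X (Suc n) \<omega> * real (Suc n) powr (- \<sigma>)) \<longlonglongrightarrow> Re (dirichlet \<omega> (of_real \<sigma>))"
    using tendsto_Re[OF assms] by (simp add: partial_sum_of_real del: of_real_sum)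
  then have *: "gauss_dirichlet X \<omega> \<sigma> = Re (dirichlet \<omega> (of_real \<sigma>))"
    unfolding gauss_dirichlet_def by (simp add: sums_def sums_unique[symmetric])
  have "(\<lambda>N. 0) \<longlonglongrightarrow> Im (dirichlet \<omega> (of_real \<sigma>))"
    using tendsto_Im[OF assms] by (simp add: partial_sum_of_real del: of_real_sum)
  then have "Im (dirichlet \<omega> (of_real \<sigma>)) = 0"
    by (simp add: LIMSEQ_const_iff)
  with * show ?thesis by (simp add: complex_eq_iff)
qed

lemma circle_mean_eq:
  assumes hol: "dirichlet \<omega> holomorphic_on {s. 1/2 < Re s}"
    and lim: "\<And>s. 1/2 < Re s \<Longrightarrow> (\<lambda>N. partial_sum \<omega> N s) \<longlonglongrightarrow> dirichlet \<omega> s"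
    and a: "0 < a"
  shows "circle_mean a \<omega> = ennreal (integral {0..1} (\<lambda>t. a * (norm (dirichlet \<omega> (circle a t)))\<^sup>2))"
proof -
  have Re: "1/2 < Re (circle a t)" for t
    using Re_circle_ge[OF a, of t] a by linarith
  have "liminf (\<lambda>N. ennreal (a * (norm (partial_sum \<omega> N (circle a t)))\<^sup>2))
      = ennreal (a * (norm (dirichlet \<omega> (circle a t)))\<^sup>2)" for t
    by (intro lim_imp_Liminf tendsto_ennrealI tendsto_intros lim Re) auto
  moreover have cont: "continuous_on {0..1} (\<lambda>t. a * (norm (dirichlet \<omega> (circle a t)))\<^sup>2)"
    using Re by (intro continuous_intros continuous_on_compose2[OF holomorphic_on_imp_continuous_on[OF hol]]
      continuous_on_circle) auto
  ultimately show ?thesis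
    unfolding circle_mean_def using a
      nn_integral_has_integral_lebesgue'[OF _ integrable_integral[OF integrable_continuous_real[OF cont]]]
    by simp
qed

text \<open>With \<open>w\<close> the right-hand side, both the normalised mean
  \<open>sqrt a * I\<close> and \<open>v\<close> are at most \<open>w\<close>. The zero bound then
  reads \<open>(3/2) ^ n \<le> sqrt a * I * v\<^sup>2 \<le> w ^ 3\<close>, and the cube root
  explains the rate \<open>ln (3/2) / 3\<close>.\<close>

lemma zeros_dyadic_bound:
  assumes hol: "dirichlet \<omega> holomorphic_on {s. 1/2 < Re s}"
    and lim: "\<And>s. 1/2 < Re s \<Longrightarrow> (\<lambda>N. partial_sum \<omega> N s) \<longlonglongrightarrow> dirichlet \<omega> s"
    and a: "0 < a"
    and fin: "1 + circle_mean a \<omega> + center_value a \<omega> < \<infinity>"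
  defines "Z \<equiv> {\<sigma>\<in>{1/2 + a..1/2 + 2 * a}. gauss_dirichlet X \<omega> \<sigma> = 0}"
  shows "finite Z \<and> ennreal (exp (ln (3/2) / 3 * real (card Z))) \<le> 1 + circle_mean a \<omega> + center_value a \<omega>"
proof -
  let ?F = "dirichlet \<omega>"
  have Rec: "1/2 < Re (center a)" using a by (simp add: center_def)
  have Re: "1/2 < Re (circle a t)" for t
    using Re_circle_ge[OF a, of t] a by linarith
  have cv: "center_value a \<omega> = inverse (ennreal (sqrt (sqrt a * norm (?F (center a)))))"
  proof -
    \<comment> \<open>Inversion on \<open>ennreal\<close> is continuous even at 0, so the limit is
      identified before \<open>F\<close> is known to be nonzero at the center.\<close>
    have "((\<lambda>x::ennreal. inverse x) \<longlongrightarrow> inverse y) (at y)" for y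
      using continuous_on_inverse_ennreal[OF continuous_on_id, of UNIV] by (simp add: continuous_on_def)
    then have "isCont (\<lambda>x::ennreal. inverse x) y" for y
      by (simp add: isCont_def)
    then show ?thesis
      unfolding center_value_def
      by (intro lim_imp_Liminf isCont_tendsto_compose[where g = "\<lambda>x::ennreal. inverse x"]
          tendsto_ennrealI tendsto_intros lim Rec) auto
  qed
  have F0: "?F (center a) \<noteq> 0"
    using fin cv by auto
  define I where "I = integral {0..1} (\<lambda>t. norm (?F (circle a t)))"
  define I2 where "I2 = integral {0..1} (\<lambda>t. a * (norm (?F (circle a t)))\<^sup>2)"
  define v where "v = inverse (sqrt (sqrt a * norm (?F (center a))))"
  define w where "w = 1 + I2 + v"
  have cont: "continuous_on {0..1} (\<lambda>t. ?F (circle a t))"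
    using Re by (intro continuous_on_compose2[OF holomorphic_on_imp_continuous_on[OF hol] continuous_on_circle]) auto
  have "0 \<le> I2" unfolding I2_def using a by (intro integral_nonneg integrable_continuous_real continuous_intros cont) auto
  have "0 \<le> I" unfolding I_def by (intro integral_nonneg integrable_continuous_real continuous_intros cont) auto
  have "0 < v" unfolding v_def using a F0 by simp
  have cm: "circle_mean a \<omega> = ennreal I2"
    unfolding I2_def by (rule circle_mean_eq[OF hol lim a])
  have W: "1 + circle_mean a \<omega> + center_value a \<omega> = ennreal w"
    unfolding cm cv w_def
    using \<open>0 \<le> I2\<close> \<open>0 < v\<close> a F0 by (simp add: inverse_ennreal v_def ennreal_plus)
  \<comment> \<open>The pointwise inequality \<open>y \<le> 1 + y\<^sup>2\<close> trades the first
    moment for the second, whose expectation is computable.\<close>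
  have "sqrt a * I \<le> 1 + I2"
  proof -
    have "sqrt a * I = integral {0..1} (\<lambda>t. sqrt a * norm (?F (circle a t)))"
      by (simp add: I_def)
    also have "\<dots> \<le> integral {0..1} (\<lambda>t. 1 + a * (norm (?F (circle a t)))\<^sup>2)"
    proof (intro integral_le integrable_continuous_real continuous_intros cont)
      fix t :: real
      define y where "y = sqrt a * norm (?F (circle a t))"
      have "y \<le> 1 + y\<^sup>2"
        using zero_le_power2[of "y - 1/2"] by (simp add: power2_eq_square algebra_simps)
      then show "sqrt a * norm (?F (circle a t)) \<le> 1 + a * (norm (?F (circle a t)))\<^sup>2"
        using a by (simp add: y_def power_mult_distrib)
    qed
    also have "\<dots> = 1 + I2"
      unfolding I2_def by (subst integral_add) (auto intro!: integrable_continuous_real continuous_intros cont)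
    finally show ?thesis .
  qed
  then have uw: "sqrt a * I \<le> w" using \<open>0 < v\<close> by (simp add: w_def)
  have vw: "v \<le> w" using \<open>0 \<le> I2\<close> by (simp add: w_def)
  \<comment> \<open>Stated for every finite set of zeros, so that it also rules out infinitely
    many.\<close>
  have key: "(3/2) ^ card B \<le> w ^ 3" if "finite B" "B \<subseteq> Z" for B
  proof -
    let ?C = "complex_of_real ` B"
    have "(5 * a / 4 - a / 2) ^ card ?C * norm (?F (center a))
        \<le> (a / 2) ^ card ?C * integral {0..1} (\<lambda>t. norm (?F (circlepath (center a) (5 * a / 4) t)))"
    proof (rule zeros_bound_circle_mean[OF open_halfspace_Re_gt hol])
      show "cball (center a) (5 * a / 4) \<subseteq> {s. 1/2 < Re s}"
      proof
        fix s assume "s \<in> cball (center a) (5 * a / 4)"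
        then have "\<bar>Re (center a) - Re s\<bar> \<le> 5 * a / 4"
          using abs_Re_le_cmod[of "center a - s"] by (simp add: dist_norm)
        from abs_le_D1[OF this] show "s \<in> {s. 1/2 < Re s}" using a by (simp add: center_def)
      qed
      show "?C \<subseteq> cball (center a) (a / 2)"
      proof clarify
        fix \<sigma> assume "\<sigma> \<in> B"
        then have "\<sigma> \<in> Z" using that(2) by blast
        then have "1/2 + a \<le> \<sigma>" "\<sigma> \<le> 1/2 + 2 * a" by (auto simp: Z_def)
        then have "\<bar>1/2 + 3 * a / 2 - \<sigma>\<bar> \<le> a / 2" unfolding abs_le_iff by argo
        then show "complex_of_real \<sigma> \<in> cball (center a) (a / 2)"
          unfolding center_def mem_cball dist_norm of_real_diff[symmetric] norm_of_real .
      qed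
      show "?F z = 0" if "z \<in> ?C" for z
      proof -
        obtain \<sigma> where \<sigma>: "z = of_real \<sigma>" "\<sigma> \<in> Z" using \<open>z \<in> ?C\<close> \<open>B \<subseteq> Z\<close> by auto
        then have "1/2 < \<sigma>" "gauss_dirichlet X \<omega> \<sigma> = 0" using a by (auto simp: Z_def)
        then show ?thesis using gauss_dirichlet_eq[OF lim, of \<sigma>] by (simp add: \<sigma>)
      qed
    qed (use a that in auto)
    moreover have "card ?C = card B" by (simp add: card_image inj_on_def)
    ultimately have "(3 * a / 4) ^ card B * norm (?F (center a)) \<le> (a / 2) ^ card B * I"
      by (simp add: I_def circle_def)
    moreover have "(3 * a / 4) ^ card B = (3/2) ^ card B * (a / 2) ^ card B"
      by (simp flip: power_mult_distrib)
    ultimately have "(a / 2) ^ card B * ((3/2) ^ card B * norm (?F (center a))) \<le> (a / 2) ^ card B * I"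
      by (simp add: mult_ac)
    then have "(3/2) ^ card B * norm (?F (center a)) \<le> I"
      using a by (subst (asm) mult_le_cancel_left_pos) auto
    then have "(3/2) ^ card B * (sqrt a * norm (?F (center a))) \<le> sqrt a * I"
      using a mult_left_mono[of _ I "sqrt a"] by (simp add: mult_ac)
    then have "(3/2) ^ card B \<le> sqrt a * I / (sqrt a * norm (?F (center a)))"
      using a F0 by (simp add: pos_le_divide_eq)
    also have "\<dots> = sqrt a * I * v\<^sup>2"
      using a F0 by (simp add: v_def power_inverse divide_inverse)
    also have "\<dots> \<le> w * w\<^sup>2"
      using uw vw \<open>0 \<le> I\<close> \<open>0 < v\<close> a by (intro mult_mono power_mono) auto
    finally show ?thesis by (simp add: power3_eq_cube power2_eq_square)
  qed
  have "finite Z"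
  proof (rule ccontr)
    assume "infinite Z"
    obtain n where "w ^ 3 < (3/2) ^ n" using real_arch_pow[of "3/2" "w ^ 3"] by auto
    moreover obtain B where "finite B" "card B = n" "B \<subseteq> Z"
      using infinite_arbitrarily_large[OF \<open>infinite Z\<close>] by blast
    ultimately show False using key[of B] by simp
  qed
  moreover have "exp (ln (3/2) / 3 * real (card Z)) \<le> w"
  proof -
    have "exp (ln (3/2) / 3 * real (card Z)) ^ 3 = exp (real (card Z) * ln (3/2))"
      by (simp flip: exp_of_nat_mult)
    also have "\<dots> = (3/2) ^ card Z"
      by (simp add: exp_of_nat_mult)
    also have "\<dots> \<le> w ^ 3"
      using key[OF \<open>finite Z\<close>] by simp
    finally show ?thesis
      using vw \<open>0 < v\<close> by (subst (asm) power_mono_iff) auto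
  qed
  ultimately show ?thesis
    unfolding W by (simp add: ennreal_leI)
qed

end

section \<open>Combining the dyadic scales\<close>

lemma powr_le_exp:
  fixes x k \<beta> :: real
  assumes "0 \<le> x" "0 < k" "0 < \<beta>"
  shows "x powr k \<le> (k / \<beta>) powr k * exp (\<beta> * x)"
proof -
  \<comment> \<open>The inequality \<open>u \<le> exp u\<close> at
    \<open>u = \<beta> * x / k\<close>, to be raised to the power \<open>k\<close>.\<close>
  have "\<beta> * x / k \<le> exp (\<beta> * x / k)"
    using exp_ge_add_one_self[of "\<beta> * x / k"] by linarith
  then have "x \<le> k / \<beta> * exp (\<beta> * x / k)"
    using assms by (simp add: field_simps)
  then have "x powr k \<le> (k / \<beta> * exp (\<beta> * x / k)) powr k"
    using assms by (intro powr_mono2) auto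
  also have "\<dots> = (k / \<beta>) powr k * exp (\<beta> * x)"
    using assms by (subst powr_mult) (auto simp: exp_powr_real)
  finally show ?thesis .
qed

text \<open>Jensen's inequality for a uniform average, obtained by summing the tangent line bound at
  the mean \<open>m\<close>, whose linear terms cancel.\<close>

lemma exp_mean_le:
  fixes y :: "nat \<Rightarrow> real"
  assumes "0 < J"
  shows "exp ((\<Sum>j<J. y j) / real J) \<le> (\<Sum>j<J. exp (y j)) / real J"
proof -
  define m where "m = (\<Sum>j<J. y j) / real J"
  have "exp m * (1 + (y j - m)) \<le> exp (y j)" for j
    using mult_left_mono[OF exp_ge_add_one_self[of "y j - m"], of "exp m"] by (simp flip: exp_add)
  then have "(\<Sum>j<J. exp m * (1 + (y j - m))) \<le> (\<Sum>j<J. exp (y j))"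
    by (intro sum_mono)
  also have "(\<Sum>j<J. exp m * (1 + (y j - m))) = exp m * (real J + ((\<Sum>j<J. y j) - real J * m))"
    by (simp add: sum.distrib sum_subtractf flip: sum_distrib_left)
  also have "\<dots> = exp m * real J"
    using assms by (simp add: m_def)
  finally show ?thesis
    using assms by (simp add: m_def pos_le_divide_eq)
qed

text \<open>Take the least \<open>j\<close> whose scale is at most \<open>x\<close>; the preceding
  scale, twice as large, exceeds \<open>x\<close>, and for \<open>j = 0\<close> the bound
  \<open>x \<le> 1/2\<close> takes its place.\<close>

lemma dyadic_scale:
  fixes x :: real
  assumes "x \<le> 1/2" "1 / 2 ^ Suc J \<le> x" "0 < J"
  obtains j where "j < J" "1 / 2 ^ (j + 2) \<le> x" "x \<le> 2 * (1 / 2 ^ (j + 2))"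
proof -
  define j where "j = (LEAST j. 1 / 2 ^ (j + 2) \<le> x)"
  have ex: "1 / 2 ^ (J - 1 + 2) \<le> x" using assms by (cases J) auto
  have "1 / 2 ^ (j + 2) \<le> x" unfolding j_def using ex by (rule LeastI[where P = "\<lambda>j. 1 / 2 ^ (j + 2) \<le> x"])
  moreover have "j \<le> J - 1" unfolding j_def using ex by (rule Least_le[where P = "\<lambda>j. 1 / 2 ^ (j + 2) \<le> x"])
  moreover have "x \<le> 2 * (1 / 2 ^ (j + 2))"
  proof (cases j)
    case 0
    then show ?thesis using assms by simp
  next
    case (Suc i)
    then have "\<not> 1 / 2 ^ (i + 2) \<le> x"
      using not_less_Least[of i "\<lambda>j. 1 / 2 ^ (j + 2) \<le> x"] unfolding j_def[symmetric] by simp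
    then show ?thesis by (simp add: Suc)
  qed
  ultimately show ?thesis using that[of j] assms(3) by linarith
qed

theorem theorem1p3:
  fixes M :: "'a measure" and X :: "nat \<Rightarrow> 'a \<Rightarrow> real"
  assumes "prob_space M"
    and "prob_space.indep_vars M (\<lambda>_. borel) X {1..}"
    and "\<And>n. n \<ge> 1 \<Longrightarrow> distributed M lborel (X n) std_normal_density"
  shows "\<exists>C::real. C > 0 \<and> (\<forall>k::real. \<forall>T::real. k \<ge> 1 \<longrightarrow> 1/2 < T \<longrightarrow> T < 1 \<longrightarrow>
    (\<integral>\<^sup>+ \<omega>. ennreal_powr (num_zeros X T 1 \<omega>) k \<partial>M)
      \<le> ennreal ((C * k * ln (1 / (T - 1/2))) powr k))"
proof -
  interpret gaussian_sequence M X
    using assms by (intro gaussian_sequence.intro gaussian_sequence_axioms.intro) auto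
  define c :: real where "c = ln (3/2) / 3"
  \<comment> \<open>14 is the bound \<open>1 + 3 + 10\<close> on the expectation of each
    \<open>W j\<close>, \<open>c\<close> the exponential rate per scale, and \<open>ln 2\<close>
    converts the binary logarithm.\<close>
  define C where "C = 14 / (c * ln 2)"
  have "0 < c" by (simp add: c_def)
  then have "0 < C" by (simp add: C_def)
  moreover have "(\<integral>\<^sup>+ \<omega>. ennreal_powr (num_zeros X T 1 \<omega>) k \<partial>M)
      \<le> ennreal ((C * k * ln (1 / (T - 1/2))) powr k)" if k: "1 \<le> k" and T: "1/2 < T" "T < 1" for k T
  proof -
    define J where "J = nat \<lfloor>log 2 (1 / (T - 1/2))\<rfloor>"
    \<comment> \<open>Starting at 1/4 makes the first interval end at 1.\<close>
    define a :: "nat \<Rightarrow> real" where "a j = 1 / 2 ^ (j + 2)" for j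
    define W where "W j \<omega> = 1 + circle_mean (a j) \<omega> + center_value (a j) \<omega>" for j \<omega>
    define Z where "Z \<omega> = {\<sigma>\<in>{T..1}. gauss_dirichlet X \<omega> \<sigma> = 0}" for \<omega>
    define B where "B = (real J * k / c) powr k"
    have [measurable]: "W j \<in> borel_measurable M" for j
      unfolding W_def by measurable
    have log_ge: "1 \<le> log 2 (1 / (T - 1/2))"
      using T by (simp add: le_log_iff field_simps)
    then have J: "1 \<le> J" "real J \<le> log 2 (1 / (T - 1/2))" "log 2 (1 / (T - 1/2)) < real (Suc J)"
      unfolding J_def by linarith+
    \<comment> \<open>The finest scale \<open>a (J - 1)\<close> equals \<open>1 / 2 ^ Suc J\<close>,
      so the \<open>J\<close> intervals reach down to \<open>T\<close>.\<close>
    have J2: "1 / 2 ^ Suc J \<le> T - 1/2"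
    proof -
      have "1 / (T - 1/2) \<le> 2 powr real (Suc J)"
        using J(3) T by (simp add: log_less_iff less_imp_le del: of_nat_Suc)
      then show ?thesis
        using T by (simp add: powr_realpow field_simps del: of_nat_Suc power_Suc)
    qed
    have a: "0 < a j" "a j \<le> 1" for j
      using one_le_power[of "2::real" "j + 2"] by (auto simp: a_def divide_le_eq_1)
    have EW: "(\<integral>\<^sup>+\<omega>. W j \<omega> \<partial>M) \<le> 14" for j
    proof -
      have "(\<integral>\<^sup>+\<omega>. W j \<omega> \<partial>M) = 1 + (\<integral>\<^sup>+\<omega>. circle_mean (a j) \<omega> \<partial>M) + (\<integral>\<^sup>+\<omega>. center_value (a j) \<omega> \<partial>M)"
        unfolding W_def by (simp add: nn_integral_add emeasure_space_1)
      also have "\<dots> \<le> 1 + 3 + 10"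
        using nn_integral_circle_mean[OF a] nn_integral_center_value[OF a(1)] by (intro add_mono) auto
      finally show ?thesis by simp
    qed
    have bound: "AE \<omega> in M. ennreal_powr (num_zeros X T 1 \<omega>) k \<le> ennreal (B / real J) * (\<Sum>j<J. W j \<omega>)"
      using AE_dirichlet
    proof eventually_elim
      fix \<omega> assume \<omega>: "dirichlet \<omega> holomorphic_on {s. 1/2 < Re s} \<and>
        (\<forall>s. 1/2 < Re s \<longrightarrow> (\<lambda>N. partial_sum \<omega> N s) \<longlonglongrightarrow> dirichlet \<omega> s)"
      \<comment> \<open>A positive factor keeps the right-hand side infinite when some
        \<open>W j \<omega>\<close> is, as \<open>0 * \<infinity>\<close> would be 0.\<close>
      have Bpos: "0 < B / real J" using J k \<open>0 < c\<close> by (simp add: B_def)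
      show "ennreal_powr (num_zeros X T 1 \<omega>) k \<le> ennreal (B / real J) * (\<Sum>j<J. W j \<omega>)"
      proof (cases "\<forall>j<J. W j \<omega> < \<infinity>")
        case False
        then have top: "(\<Sum>j<J. W j \<omega>) = \<infinity>"
          by (auto simp: not_less top_unique)
        show ?thesis using Bpos unfolding top by (auto simp: ennreal_mult_top)
      next
        case True
        define Y where "Y j = {\<sigma>\<in>{1/2 + a j..1/2 + 2 * a j}. gauss_dirichlet X \<omega> \<sigma> = 0}" for j
        have Y: "finite (Y j)" "ennreal (exp (c * real (card (Y j)))) \<le> W j \<omega>" if "j < J" for j
          using zeros_dyadic_bound[of \<omega> "a j"] \<omega> a(1)[of j] True that
          unfolding Y_def W_def c_def by auto
        have sub: "Z \<omega> \<subseteq> (\<Union>j<J. Y j)"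
        proof
          fix \<sigma> assume \<sigma>: "\<sigma> \<in> Z \<omega>"
          then obtain j where "j < J" "a j \<le> \<sigma> - 1/2" "\<sigma> - 1/2 \<le> 2 * a j"
            using dyadic_scale[of "\<sigma> - 1/2" J] J J2 unfolding a_def Z_def by auto
          then show "\<sigma> \<in> (\<Union>j<J. Y j)" using \<sigma> by (intro UN_I[of j]) (auto simp: Y_def Z_def)
        qed
        have fin: "finite (Z \<omega>)"
          using finite_subset[OF sub] Y(1) by auto
        have card: "real (card (Z \<omega>)) \<le> (\<Sum>j<J. real (card (Y j)))"
        proof -
          have "card (Z \<omega>) \<le> card (\<Union>j<J. Y j)" using sub Y(1) by (intro card_mono) auto
          also have "\<dots> \<le> (\<Sum>j<J. card (Y j))" by (intro card_UN_le) simp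
          finally show ?thesis by (simp flip: of_nat_sum)
        qed
        have "num_zeros X T 1 \<omega> = ennreal (real (card (Z \<omega>)))"
          using fin unfolding num_zeros_def Z_def[symmetric]
          by (simp add: emeasure_count_space_finite ennreal_of_nat_eq_real_of_nat)
        then have "ennreal_powr (num_zeros X T 1 \<omega>) k = ennreal (real (card (Z \<omega>)) powr k)"
          by (simp add: ennreal_powr_def)
        \<comment> \<open>The rate \<open>c / J\<close> turns the total count into an average over
          the scales, ready for convexity.\<close>
        also have "\<dots> \<le> ennreal ((k / (c / real J)) powr k * exp (c / real J * real (card (Z \<omega>))))"
          using k J \<open>0 < c\<close> by (intro ennreal_leI powr_le_exp) auto
        also have "(k / (c / real J)) powr k = B"
          by (simp add: B_def mult.commute)
        also have "ennreal (B * exp (c / real J * real (card (Z \<omega>))))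
            \<le> ennreal (B / real J * (\<Sum>j<J. exp (c * real (card (Y j)))))"
        proof (rule ennreal_leI)
          have "c / real J * real (card (Z \<omega>)) \<le> (\<Sum>j<J. c * real (card (Y j))) / real J"
            using card \<open>0 < c\<close> J by (simp add: divide_right_mono mult_left_mono flip: sum_distrib_left)
          then have "exp (c / real J * real (card (Z \<omega>))) \<le> exp ((\<Sum>j<J. c * real (card (Y j))) / real J)"
            by simp
          also have "\<dots> \<le> (\<Sum>j<J. exp (c * real (card (Y j)))) / real J"
            using J by (intro exp_mean_le) auto
          finally have "exp (c / real J * real (card (Z \<omega>))) \<le> (\<Sum>j<J. exp (c * real (card (Y j)))) / real J" .
          from mult_left_mono[OF this, of B]
          show "B * exp (c / real J * real (card (Z \<omega>))) \<le> B / real J * (\<Sum>j<J. exp (c * real (card (Y j))))"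
            by (simp add: B_def)
        qed
        also have "\<dots> = ennreal (B / real J) * ennreal (\<Sum>j<J. exp (c * real (card (Y j))))"
          using Bpos by (intro ennreal_mult sum_nonneg) auto
        also have "ennreal (\<Sum>j<J. exp (c * real (card (Y j)))) = (\<Sum>j<J. ennreal (exp (c * real (card (Y j)))))"
          by (rule sum_ennreal[symmetric]) simp
        also have "ennreal (B / real J) * (\<Sum>j<J. ennreal (exp (c * real (card (Y j)))))
            \<le> ennreal (B / real J) * (\<Sum>j<J. W j \<omega>)"
          using Y(2) by (intro mult_left_mono sum_mono) auto
        finally show ?thesis .
      qed
    qed
    have "(\<integral>\<^sup>+ \<omega>. ennreal_powr (num_zeros X T 1 \<omega>) k \<partial>M)
        \<le> (\<integral>\<^sup>+\<omega>. ennreal (B / real J) * (\<Sum>j<J. W j \<omega>) \<partial>M)"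
      using bound by (rule nn_integral_mono_AE)
    \<comment> \<open>Linearity of expectation suffices here, although the scales share the same
      random variables.\<close>
    also have "\<dots> = ennreal (B / real J) * (\<Sum>j<J. \<integral>\<^sup>+\<omega>. W j \<omega> \<partial>M)"
      by (simp add: nn_integral_cmult nn_integral_sum)
    also have "\<dots> \<le> ennreal (B / real J) * (\<Sum>j<J. 14)"
      using EW by (intro mult_left_mono sum_mono) auto
    also have "\<dots> = ennreal (14 * B)"
    proof -
      have "(\<Sum>j<J. 14::ennreal) = ennreal (real J * 14)"
        by (simp add: ennreal_mult ennreal_of_nat_eq_real_of_nat)
      then show ?thesis
        using J by (simp add: B_def flip: ennreal_mult)
    qed
    also have "\<dots> \<le> ennreal ((C * k * ln (1 / (T - 1/2))) powr k)"
    proof (rule ennreal_leI)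
      \<comment> \<open>Since \<open>k\<close> is at least 1, the constant can be absorbed into the
        base of the power.\<close>
      have "14 * B \<le> 14 powr k * B"
        using powr_mono[of 1 k 14] k by (intro mult_right_mono) (auto simp: B_def)
      also have "\<dots> = (14 * (real J * k / c)) powr k"
        using k \<open>0 < c\<close> unfolding B_def by (subst powr_mult) auto
      also have "\<dots> \<le> (C * k * ln (1 / (T - 1/2))) powr k"
      proof (rule powr_mono2)
        have "14 * (real J * k / c) \<le> 14 * (log 2 (1 / (T - 1/2)) * k / c)"
          using J k \<open>0 < c\<close> by (intro mult_left_mono divide_right_mono mult_right_mono) auto
        also have "\<dots> = C * k * ln (1 / (T - 1/2))"
          by (simp add: C_def log_def mult_ac)
        finally show "14 * (real J * k / c) \<le> C * k * ln (1 / (T - 1/2))" .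
      qed (use k \<open>0 < c\<close> in auto)
      finally show "14 * B \<le> (C * k * ln (1 / (T - 1/2))) powr k" .
    qed
    finally show ?thesis .
  qed
  ultimately show ?thesis by blast
qed

end
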